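(* Let $G$ and $H$ be modules over a principal ideal domain $R$. Suppose $\mathcal{C}$ is a partial decomposition basis for $G$ and $I: G \cong_p H$ is a partial isomorphism. Then $$\mathcal{C}' = \{f(X) : X \in \mathcal{C},\ f \in I,\ X \subseteq \operatorname{domain}(f)\}$$ is a partial decomposition basis for $H$. In particular, if $G\cong_p H$ and $G$ has a partial decomposition basis, then so does $H$.
   Context: A partial isomorphism $I: G \cong_p H$ is a nonempty set $I$ of isomorphisms between submodules of $G$ and submodules of $H$ such that for any $f \in I$ and $a \in G$ (resp. $b \in H$) there is $g \in I$ with $f \subseteq g$ and $a \in \operatorname{domain}(g)$ (resp. $b \in \operatorname{range}(g)$); $G\cong_p H$ means such an $I$ exists. For a prime $p$ of $R$, define $p^0G=G$, $p^{\beta+1}G=p(p^\beta G)$, $p^\alpha G=\bigcap_{\beta<\alpha}p^\beta G$ for limit $\alpha$; the $p$-height $|x|_p$ is the ordinal $\alpha$ with $x\in p^\alpha G\setminus p^{\alpha+1}G$, or $\infty$ if none exists. A subset $X\subseteq G$ is a decomposition set if $X$ is an $R$-linearly independent set of elements of infinite order and for all $x_1,\dots,x_n\in X$, $a_1,\dots,a_n\in R$ and every prime $p$ of $R$, $|a_1x_1+\cdots+a_nx_n|_p=\min_{1\le i\le n}|a_ix_i|_p$. For a submodule $K$ of $G$, $K^0=\{x\in G: ax\in K \text{ for some } a\in R\setminus\{0\}\}$; $\langle X\rangle$ denotes the submodule generated by $X$. A partial decomposition basis for $G$ is a collection $\mathcal{C}$ such that (i) $\mathcal{C}$ is a nonempty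 collection of finite subsets of $G$; (ii) each $X\in\mathcal{C}$ is a decomposition set; (iii) if $X\in\mathcal{C}$ and $x\in G$, there is $Y\in\mathcal{C}$ with $X\subseteq Y$ and $x\in\langle Y\rangle^0$. *)

theory Defs
  imports Complex_Main "HOL-Computational_Algebra.Factorial_Ring" "HOL-Library.Extended"
begin

section \<open>Ordinals\<close>

text \<open>
  HOL has no type of all ordinals. An element of \<open>'a ordinal\<close> is an isomorphism class
  (order type) of well-orders on subsets of \<open>'a + nat\<close>, so the type consists of
  all ordinals of cardinality at most \<open>max |'a| \<aleph>\<^sub>0\<close>, and it has no largest element.
  For a module \<open>G\<close> on the type \<open>'a\<close> nothing is lost by stopping there: choosing an element of
  \<open>p\<^sup>\<alpha>G - p\<^sup>\<alpha>\<^sup>+\<^sup>1G\<close> for every \<open>\<alpha>\<close> at which the chain drops shows that it becomes stationary at some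
  ordinal of cardinality at most \<open>|G|\<close>. Hence every ordinal height is represented, and
  a height that does not exist here does not exist at all.
\<close>

quotient_type 'a ordinal = "('a + nat) rel" / partial: "\<lambda>r s. (r, s) \<in> ordIso"
proof (rule part_equivpI)
  show "\<exists>r :: ('a + nat) rel. (r, r) \<in> ordIso"
    using card_of_Well_order ordIso_reflexive by blast
  show "symp (\<lambda>r s :: ('a + nat) rel. (r, s) \<in> ordIso)"
    by (auto intro: sympI ordIso_symmetric)
  show "transp (\<lambda>r s :: ('a + nat) rel. (r, s) \<in> ordIso)"
    by (auto intro: transpI ordIso_transitive)
qed

lemma ordIso_Well_order: "(r, s) \<in> ordIso \<Longrightarrow> Well_order r \<and> Well_order s"
  unfolding ordIso_def by auto

instantiation ordinal :: (type) wellorder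
begin

lift_definition less_eq_ordinal :: "'a ordinal \<Rightarrow> 'a ordinal \<Rightarrow> bool" is "\<lambda>r s. (r, s) \<in> ordLeq"
  by (meson ordIso_ordLeq_trans ordIso_symmetric ordLeq_ordIso_trans)

lift_definition less_ordinal :: "'a ordinal \<Rightarrow> 'a ordinal \<Rightarrow> bool" is "\<lambda>r s. (r, s) \<in> ordLess"
  by (meson ordIso_ordLess_trans ordIso_symmetric ordLess_ordIso_trans)

instance
proof
  fix x y z :: "'a ordinal"
  show "(x < y) = (x \<le> y \<and> \<not> y \<le> x)"
    by transfer (meson not_ordLess_ordLeq not_ordLeq_ordLess ordIso_Well_order
        ordLess_imp_ordLeq ordLess_or_ordLeq)
  show "x \<le> x"
    by transfer (meson ordIso_imp_ordLeq)
  show "x \<le> y \<Longrightarrow> y \<le> z \<Longrightarrow> x \<le> z"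
    by transfer (meson ordLeq_transitive)
  show "x \<le> y \<Longrightarrow> y \<le> x \<Longrightarrow> x = y"
    by transfer (simp add: ordIso_iff_ordLeq)
  show "x \<le> y \<or> y \<le> x"
    by transfer (meson ordIso_Well_order ordLeq_total)
next
  fix P :: "'a ordinal \<Rightarrow> bool" and x
  assume step: "\<And>x. (\<And>y. y < x \<Longrightarrow> P y) \<Longrightarrow> P x"
  have "P (abs_ordinal r)" if "(r, r) \<in> ordIso" for r
    using wf_ordLess that
  proof (induction r rule: wf_induct_rule)
    case (less r)
    show ?case
    proof (rule step)
      fix y assume y: "y < abs_ordinal r"
      obtain s where s: "y = abs_ordinal s" "(s, s) \<in> ordIso"
        by (induction y rule: ordinal.abs_induct) blast
      with y less.prems have "(s, r) \<in> ordLess"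
        by (simp add: less_ordinal.abs_eq)
      with less.IH s show "P y" by blast
    qed
  qed
  then show "P x"
    by (induction x rule: ordinal.abs_induct) blast
qed

end

lemma ex_greater_ordinal: "\<exists>\<beta>. \<alpha> < (\<beta> :: 'a ordinal)"
proof transfer
  fix r :: "('a + nat) rel"
  assume "(r, r) \<in> ordIso"
  then have wo: "Well_order r" by (simp add: ordIso_Well_order)
  define e :: "'a + nat \<Rightarrow> 'a + nat" where "e = map_sum id Suc"
  have inj: "inj_on e (Field r)"
    by (auto simp: e_def inj_on_def map_sum_def split: sum.splits)
  define t :: "'a + nat" where "t = Inr 0"
  define q where "q = dir_image r e"
  have q: "Well_order q" "(r, q) \<in> ordIso"
    using wo inj by (simp_all add: q_def Well_order_dir_image dir_image_ordIso)
  have t: "t \<notin> Field q"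
    by (auto simp: q_def dir_image_Field t_def e_def map_sum_def split: sum.splits)
  define s where "s = q \<union> insert t (Field q) \<times> {t}"
  have F: "Field s = insert t (Field q)"
    by (auto simp: s_def Field_def)
  have qF: "x \<in> Field q \<and> y \<in> Field q" if "(x, y) \<in> q" for x y
    using that by (auto simp: Field_def)
  have ws: "Well_order s"
    unfolding well_order_on_def linear_order_on_def partial_order_on_def preorder_on_def
  proof (intro conjI)
    have qq: "Refl q" "trans q" "antisym q" "Total q" "wf (q - Id)"
      using q(1) by (auto simp: well_order_on_def linear_order_on_def partial_order_on_def
          preorder_on_def)
    show "s \<subseteq> Field s \<times> Field s"
      by (auto simp: Field_def)
    show "Refl s"
      unfolding F using qq(1) by (auto simp: refl_on_def s_def)
    show "trans s"
      using qq(2) t qF unfolding trans_def s_def by blast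
    show "antisym s"
      using qq(3) t qF unfolding antisym_def s_def by blast
    show "Total s"
      unfolding F using qq(4) unfolding total_on_def s_def by blast
    have "wf ((q - Id) \<union> Field q \<times> {t})"
    proof (rule wf_Un)
      show "wf (Field q \<times> {t})"
        using t by (intro wfI_min) (auto, metis)
    qed (use qq(5) t qF in auto)
    moreover have "s - Id = (q - Id) \<union> Field q \<times> {t}"
      using t by (auto simp: s_def)
    ultimately show "wf (s - Id)" by simp
  qed
  have "Order_Relation.underS s t = Field q"
    using t qF by (auto simp: Order_Relation.underS_def s_def)
  moreover have "Restr s (Field q) = q"
    using t qF by (auto simp: s_def)
  ultimately have "(q, s) \<in> ordLess"
    using underS_Restr_ordLess[OF ws, of t] F by simp
  with q(2) have "(r, s) \<in> ordLess" by (rule ordIso_ordLess_trans)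
  moreover have "(s, s) \<in> ordIso" using ws by (rule ordIso_reflexive)
  ultimately show "\<exists>s\<in>{x :: ('a + nat) rel. (x, x) \<in> ordIso}. (r, s) \<in> ordLess"
    by (intro bexI[of _ s]) simp_all
qed

definition ord_suc :: "'a ordinal \<Rightarrow> 'a ordinal"
  where "ord_suc \<alpha> = (LEAST \<beta>. \<alpha> < \<beta>)"

definition ord_zero :: "'a ordinal"
  where "ord_zero = (LEAST \<beta>. True)"

lemma less_ord_suc [simp]: "\<alpha> < ord_suc \<alpha>"
  unfolding ord_suc_def using ex_greater_ordinal by (rule LeastI_ex)

lemma ord_suc_le_iff: "ord_suc \<alpha> \<le> \<beta> \<longleftrightarrow> \<alpha> < \<beta>"
  by (metis Least_le less_le_trans less_ord_suc ord_suc_def)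

lemma ord_suc_inject [simp]: "ord_suc \<alpha> = ord_suc \<beta> \<longleftrightarrow> \<alpha> = \<beta>"
  by (metis less_ord_suc linorder_neqE not_le ord_suc_le_iff)

lemma ord_zero_le [simp]: "ord_zero \<le> \<alpha>"
  unfolding ord_zero_def by (simp add: Least_le)

lemma ord_suc_neq_zero [simp]: "ord_suc \<alpha> \<noteq> ord_zero"
  by (metis leD less_ord_suc ord_zero_le)

definition is_limit :: "'a ordinal \<Rightarrow> bool"
  where "is_limit \<alpha> \<longleftrightarrow> \<alpha> \<noteq> ord_zero \<and> (\<nexists>\<beta>. \<alpha> = ord_suc \<beta>)"


section \<open>Principal ideal domains\<close>

class principal_ideal_domain = idom +
  assumes principal_ideal:
    "\<lbrakk>0 \<in> I; \<And>x y. x \<in> I \<Longrightarrow> y \<in> I \<Longrightarrow> x + y \<in> I; \<And>r x. x \<in> I \<Longrightarrow> r * x \<in> I\<rbrakk>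
      \<Longrightarrow> \<exists>a. I = range (\<lambda>r. r * a)"


section \<open>Heights and partial decomposition bases\<close>

type_synonym ('r, 'g) scaling = "'r \<Rightarrow> 'g \<Rightarrow> 'g"

function p_power ::
  "('r::comm_ring_1, 'g::ab_group_add) scaling \<Rightarrow> 'r \<Rightarrow> 'g ordinal \<Rightarrow> 'g set" where
  "p_power scale p \<alpha> =
     (if \<alpha> = ord_zero then UNIV
      else if \<exists>\<beta>. \<alpha> = ord_suc \<beta> then scale p ` p_power scale p (THE \<beta>. \<alpha> = ord_suc \<beta>)
      else (\<Inter>\<beta>\<in>{..<\<alpha>}. p_power scale p \<beta>))"
  by auto
termination
  by (relation "inv_image {(\<alpha>, \<beta>). \<alpha> < \<beta>} (snd \<circ> snd)") (auto simp: wf)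

declare p_power.simps [simp del]

lemma p_power_zero: "p_power scale p ord_zero = UNIV"
  by (subst p_power.simps) simp

lemma p_power_suc: "p_power scale p (ord_suc \<beta>) = scale p ` p_power scale p \<beta>"
  by (subst p_power.simps) auto

lemma p_power_limit:
  "is_limit \<alpha> \<Longrightarrow> p_power scale p \<alpha> = (\<Inter>\<beta>\<in>{..<\<alpha>}. p_power scale p \<beta>)"
  by (subst p_power.simps) (auto simp: is_limit_def)

text \<open>The height \<open>\<infinity>\<close> is \<open>Pinf\<close>; the value \<open>Minf\<close> of the library type is never taken.
  The ordinal in the first case is unique because \<open>\<alpha> \<mapsto> p\<^sup>\<alpha>G\<close> is decreasing.\<close>

definition p_height ::
  "('r::comm_ring_1, 'g::ab_group_add) scaling \<Rightarrow> 'r \<Rightarrow> 'g \<Rightarrow> 'g ordinal extended" where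
  "p_height scale p x =
     (if \<exists>\<alpha>. x \<in> p_power scale p \<alpha> - p_power scale p (ord_suc \<alpha>)
      then Fin (THE \<alpha>. x \<in> p_power scale p \<alpha> - p_power scale p (ord_suc \<alpha>))
      else Pinf)"

text \<open>The elements \<open>x\<^sub>1, \<dots>, x\<^sub>n\<close> in the height condition are distinct and \<open>n \<ge> 1\<close>;
  they are given as a finite nonempty subset.\<close>

definition decomposition_set ::
  "('r::idom, 'g::ab_group_add) scaling \<Rightarrow> 'g set \<Rightarrow> bool" where
  "decomposition_set scale X \<longleftrightarrow>
     \<not> module.dependent scale X \<and>
     (\<forall>x\<in>X. \<forall>a. scale a x = 0 \<longrightarrow> a = 0) \<and>
     (\<forall>S a p. finite S \<longrightarrow> S \<noteq> {} \<longrightarrow> S \<subseteq> X \<longrightarrow> prime_elem p \<longrightarrow>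
        p_height scale p (\<Sum>x\<in>S. scale (a x) x) =
        Min ((\<lambda>x. p_height scale p (scale (a x) x)) ` S))"

definition torsion_closure ::
  "('r::comm_ring_1, 'g::ab_group_add) scaling \<Rightarrow> 'g set \<Rightarrow> 'g set" where
  "torsion_closure scale K = {x. \<exists>a. a \<noteq> 0 \<and> scale a x \<in> K}"

definition partial_decomposition_basis ::
  "('r::idom, 'g::ab_group_add) scaling \<Rightarrow> 'g set set \<Rightarrow> bool" where
  "partial_decomposition_basis scale C \<longleftrightarrow>
     C \<noteq> {} \<and> (\<forall>X\<in>C. finite X) \<and>
     (\<forall>X\<in>C. decomposition_set scale X) \<and>
     (\<forall>X\<in>C. \<forall>x. \<exists>Y\<in>C. X \<subseteq> Y \<and> x \<in> torsion_closure scale (module.span scale Y))"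


section \<open>Partial isomorphisms\<close>

text \<open>A map between subsets of the two modules is a partial function \<open>f\<close> with domain
  \<open>dom f\<close> and range \<open>ran f\<close>; inclusion of graphs is \<open>\<subseteq>\<^sub>m\<close>.\<close>

definition submodule_iso ::
  "('r::comm_ring_1, 'g::ab_group_add) scaling \<Rightarrow> ('r, 'h::ab_group_add) scaling \<Rightarrow>
    ('g \<rightharpoonup> 'h) \<Rightarrow> bool" where
  "submodule_iso s1 s2 f \<longleftrightarrow>
     module.subspace s1 (dom f) \<and> module.subspace s2 (ran f) \<and> inj_on f (dom f) \<and>
     (\<forall>x\<in>dom f. \<forall>y\<in>dom f. the (f (x + y)) = the (f x) + the (f y)) \<and>
     (\<forall>r. \<forall>x\<in>dom f. the (f (s1 r x)) = s2 r (the (f x)))"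

definition partial_isomorphism ::
  "('r::comm_ring_1, 'g::ab_group_add) scaling \<Rightarrow> ('r, 'h::ab_group_add) scaling \<Rightarrow>
    ('g \<rightharpoonup> 'h) set \<Rightarrow> bool" where
  "partial_isomorphism s1 s2 I \<longleftrightarrow>
     I \<noteq> {} \<and> (\<forall>f\<in>I. submodule_iso s1 s2 f) \<and>
     (\<forall>f\<in>I. \<forall>a. \<exists>g\<in>I. f \<subseteq>\<^sub>m g \<and> a \<in> dom g) \<and>
     (\<forall>f\<in>I. \<forall>b. \<exists>g\<in>I. f \<subseteq>\<^sub>m g \<and> b \<in> ran g)"

definition partially_isomorphic ::
  "('r::comm_ring_1, 'g::ab_group_add) scaling \<Rightarrow> ('r, 'h::ab_group_add) scaling \<Rightarrow> bool" where
  "partially_isomorphic s1 s2 \<longleftrightarrow> (\<exists>I. partial_isomorphism s1 s2 I)"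

end

theory Submission
  imports Defs
begin

text \<open>
  Back-and-forth inside \<open>I\<close> shows that, if \<open>x \<in> A \<longleftrightarrow> f x \<in> B\<close> for all \<open>f \<in> I\<close> and \<open>x \<in> domain(f)\<close>,
  then the same holds for \<open>pA\<close> and \<open>pB\<close>. Hence every \<open>p\<^sup>\<beta>H\<close> is matched with some \<open>p\<^sup>\<alpha>G\<close>, and the maps
  in \<open>I\<close> preserve the order between heights, which is all the minimum condition on decomposition
  sets depends on. Heights in \<open>G\<close> and \<open>H\<close> belong to different types and are never compared directly.
  Intersections of members of the chain of all \<open>p\<^sup>\<alpha>G\<close> are again members of it because it becomes stationary,
  which holds as \<open>'g ordinal\<close> does not inject into \<open>'g\<close>.
\<close>

section \<open>Size of the type of ordinals\<close>

text \<open>Burali-Forti argument: an injection would copy the order \<open>W\<close> of all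
  ordinals to a well-order \<open>r\<close> that itself has an order type in
  \<open>'a ordinal\<close>. Then \<open>r\<close> embeds into a proper initial segment of
  \<open>W\<close>, which is isomorphic to \<open>r\<close>, so \<open>r\<close> is shorter than
  itself.\<close>

lemma not_inj_ordinal: "\<not> inj (e :: 'a ordinal \<Rightarrow> 'a)"
proof
  assume "inj e"
  define W :: "'a ordinal rel" where "W = {(\<alpha>, \<beta>). \<alpha> \<le> \<beta>}"
  have F: "Field W = UNIV"
    by (auto simp: W_def Field_def)
  have W: "Well_order W"
    unfolding well_order_on_def linear_order_on_def partial_order_on_def preorder_on_def F
  proof (intro conjI)
    show "trans W"
      unfolding W_def by (rule transI) auto
    have "W - Id = {(\<alpha>, \<beta>). \<alpha> < \<beta>}"
      by (auto simp: W_def)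
    then show "wf (W - Id)"
      by (simp add: wf)
  qed (auto simp: W_def refl_on_def antisym_def total_on_def)
  have below: "Order_Relation.underS W \<gamma> = {..<\<gamma>}" for \<gamma>
    by (auto simp: W_def Order_Relation.underS_def)
  have init_less: "(Restr W {..<\<delta>}, Restr W {..<\<gamma>}) \<in> ordLess" if "\<delta> < \<gamma>" for \<delta> \<gamma>
  proof -
    have wo: "Well_order (Restr W {..<\<gamma>})"
      using W by (rule Well_order_Restr)
    have F\<gamma>: "Field (Restr W {..<\<gamma>}) = {..<\<gamma>}"
      by (auto simp: W_def Field_def)
    have "Order_Relation.underS (Restr W {..<\<gamma>}) \<delta> = {..<\<delta>}"
      using that by (auto simp: W_def Order_Relation.underS_def)
    moreover have "Restr (Restr W {..<\<gamma>}) {..<\<delta>} = Restr W {..<\<delta>}"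
      using that by auto
    ultimately show ?thesis
      using underS_Restr_ordLess[OF wo, of \<delta>] that F\<gamma> by auto
  qed
  \<comment> \<open>By induction on \<open>ordLess\<close>: a proper initial segment of
    \<open>r\<close> embeds below its own order type, which is smaller than that of
    \<open>r\<close>, so it is strictly shorter than the segment of \<open>W\<close> below
    \<open>abs_ordinal r\<close>.\<close>
  have init: "(r, Restr W {..<abs_ordinal r}) \<in> ordLeq" if "Well_order r" for r
    using wf_ordLess that
  proof (induction r rule: wf_induct_rule)
    case (less r)
    have "(Restr r (Order_Relation.underS r a), Restr W {..<abs_ordinal r}) \<in> ordLess"
      if a: "a \<in> Field r" for a
    proof -
      let ?s = "Restr r (Order_Relation.underS r a)"
      have s: "Well_order ?s" "(?s, r) \<in> ordLess"
        using less.prems a by (auto intro: Well_order_Restr underS_Restr_ordLess)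
      then have "abs_ordinal ?s < abs_ordinal r"
        using less.prems by (simp add: less_ordinal.abs_eq ordIso_reflexive)
      then show ?thesis
        using less.IH[OF s(2,1)] init_less ordLeq_ordLess_trans by blast
    qed
    then show ?case
      using ordLeq_iff_ordLess_Restr[OF less.prems Well_order_Restr[OF W]] by blast
  qed
  \<comment> \<open>\<open>Inl\<close> moves the copy into \<open>'a + nat\<close>, where the
    representatives of \<open>'a ordinal\<close> live.\<close>
  define r where "r = dir_image W (Inl \<circ> e :: 'a ordinal \<Rightarrow> 'a + nat)"
  have inj: "inj_on (Inl \<circ> e :: 'a ordinal \<Rightarrow> 'a + nat) (Field W)"
    using \<open>inj e\<close> by (simp add: F inj_compose)
  have r: "Well_order r" "(W, r) \<in> ordIso"
    using W inj unfolding r_def by (simp_all add: Well_order_dir_image dir_image_ordIso)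
  have "(Restr W {..<abs_ordinal r}, W) \<in> ordLess"
    using underS_Restr_ordLess[OF W, of "abs_ordinal r"] by (simp add: F below)
  then have "(r, r) \<in> ordLess"
    using init[OF r(1)] r(2) by (meson ordLeq_ordLess_trans ordLess_ordIso_trans)
  then show False
    by (simp add: ordLess_irreflexive)
qed

section \<open>The descending chain of p-powers\<close>

lemma ordinal_cases:
  obtains (zero) "\<alpha> = ord_zero" | (suc) \<beta> where "\<alpha> = ord_suc \<beta>" | (limit) "is_limit \<alpha>"
  unfolding is_limit_def by blast

lemma scale_p_power_subset: "scale p ` p_power scale p \<alpha> \<subseteq> p_power scale p \<alpha>"
proof (induction \<alpha> rule: less_induct)
  case (less \<alpha>)
  show ?case
  proof (cases \<alpha> rule: ordinal_cases)
    case zero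
    then show ?thesis by (simp add: p_power_zero)
  next
    case (suc \<beta>)
    then show ?thesis
      using less[of \<beta>] by (auto simp: p_power_suc)
  next
    case limit
    then show ?thesis
      using less by (fastforce simp: p_power_limit)
  qed
qed

lemma p_power_antimono:
  assumes "\<alpha> \<le> \<beta>"
  shows "p_power scale p \<beta> \<subseteq> p_power scale p \<alpha>"
  using assms
proof (induction \<beta> rule: less_induct)
  case (less \<beta>)
  show ?case
  proof (cases "\<alpha> = \<beta>")
    case False
    with less.prems have "\<alpha> < \<beta>" by simp
    show ?thesis
    proof (cases \<beta> rule: ordinal_cases)
      case zero
      then show ?thesis
        using \<open>\<alpha> < \<beta>\<close> by (simp add: leD)
    next
      case (suc \<gamma>)
      then have "\<alpha> \<le> \<gamma>"
        using \<open>\<alpha> < \<beta>\<close> by (metis leD not_le_imp_less ord_suc_le_iff)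
      then show ?thesis
        using less.IH[of \<gamma>] scale_p_power_subset[of scale p \<gamma>] suc by (auto simp: p_power_suc)
    next
      case limit
      then show ?thesis
        using \<open>\<alpha> < \<beta>\<close> by (auto simp: p_power_limit)
    qed
  qed simp
qed

text \<open>Elements witnessing drops at different ordinals are distinct, so a drop at every ordinal
  would inject \<open>'g ordinal\<close> into \<open>'g\<close>.\<close>

lemma p_power_stationary:
  fixes scale :: "('r::comm_ring_1, 'g::ab_group_add) scaling"
  shows "\<exists>\<alpha>. \<forall>\<beta>. p_power scale p \<alpha> \<subseteq> p_power scale p \<beta>"
proof (rule ccontr)
  assume nonstat: "\<not> ?thesis"
  have "\<exists>x. x \<in> p_power scale p \<alpha> - p_power scale p (ord_suc \<alpha>)" for \<alpha>
  proof (rule ccontr)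
    assume "\<nexists>x. x \<in> p_power scale p \<alpha> - p_power scale p (ord_suc \<alpha>)"
    then have step: "p_power scale p \<alpha> \<subseteq> scale p ` p_power scale p \<alpha>"
      by (auto simp: p_power_suc)
    \<comment> \<open>One missing drop suffices: multiplication by \<open>p\<close> then loses
      nothing, and limits only intersect sets already known to contain the power at
      \<alpha>.\<close>
    have "p_power scale p \<alpha> \<subseteq> p_power scale p \<beta>" for \<beta>
    proof (induction \<beta> rule: less_induct)
      case (less \<beta>)
      show ?case
      proof (cases \<beta> rule: ordinal_cases)
        case zero
        then show ?thesis by (simp add: p_power_zero)
      next
        case (suc \<gamma>)
        then have "p_power scale p \<alpha> \<subseteq> p_power scale p \<gamma>"
          using less[of \<gamma>] by simp
        then show ?thesis
          using step unfolding suc p_power_suc by (meson image_mono order_trans)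
      next
        case limit
        then show ?thesis
          using less by (auto simp: p_power_limit)
      qed
    qed
    with nonstat show False by blast
  qed
  then obtain e where e: "\<And>\<alpha>. e \<alpha> \<in> p_power scale p \<alpha> - p_power scale p (ord_suc \<alpha>)"
    by metis
  have "e \<alpha> \<noteq> e \<beta>" if "\<alpha> < \<beta>" for \<alpha> \<beta>
    using e[of \<alpha>] e[of \<beta>] p_power_antimono[of "ord_suc \<alpha>" \<beta> scale p] that
    by (auto simp: ord_suc_le_iff)
  then have "inj e"
    by (metis injI linorder_neqE)
  then show False
    using not_inj_ordinal by blast
qed

text \<open>The exponent is the least one whose power lies inside the intersection; stationarity
  provides at least one such exponent.\<close>

lemma INT_p_power: "\<exists>\<alpha>. (\<Inter>\<sigma>\<in>S. p_power scale p \<sigma>) = p_power scale p \<alpha>"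
proof -
  let ?T = "\<Inter>\<sigma>\<in>S. p_power scale p \<sigma>"
  define \<alpha> where "\<alpha> = (LEAST \<alpha>. p_power scale p \<alpha> \<subseteq> ?T)"
  have "\<exists>\<alpha>. p_power scale p \<alpha> \<subseteq> ?T"
    using p_power_stationary[of scale p] by blast
  then have sub: "p_power scale p \<alpha> \<subseteq> ?T"
    unfolding \<alpha>_def by (rule LeastI_ex)
  \<comment> \<open>By minimality of \<alpha>, some \<sigma> in \<open>S\<close> lies strictly above
    \<beta>. The bound is stated at \<open>ord_suc \<beta>\<close> so that it reaches \<alpha>
    itself when \<alpha> is a successor.\<close>
  have super: "?T \<subseteq> p_power scale p (ord_suc \<beta>)" if "\<beta> < \<alpha>" for \<beta>
  proof -
    have "\<not> p_power scale p \<beta> \<subseteq> ?T"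
      using that unfolding \<alpha>_def by (rule not_less_Least)
    then obtain \<sigma> where \<sigma>: "\<sigma> \<in> S" "\<not> p_power scale p \<beta> \<subseteq> p_power scale p \<sigma>"
      by blast
    then have "ord_suc \<beta> \<le> \<sigma>"
      using p_power_antimono[of \<sigma> \<beta> scale p] unfolding ord_suc_le_iff by (meson not_le)
    with \<sigma>(1) show ?thesis
      using p_power_antimono[of "ord_suc \<beta>" \<sigma> scale p] by blast
  qed
  have "?T \<subseteq> p_power scale p \<alpha>"
  proof (cases \<alpha> rule: ordinal_cases)
    case zero
    then show ?thesis by (simp add: p_power_zero)
  next
    case (suc \<beta>)
    then show ?thesis
      using super[of \<beta>] by simp
  next
    case limit
    have "?T \<subseteq> p_power scale p \<beta>" if "\<beta> < \<alpha>" for \<beta>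
      using super[OF that] p_power_antimono[of \<beta> "ord_suc \<beta>" scale p]
      by (meson less_imp_le less_ord_suc order_trans)
    with limit show ?thesis
      by (auto simp: p_power_limit)
  qed
  with sub show ?thesis by blast
qed

section \<open>Heights as membership in the chain\<close>

lemma p_height_eq_Fin:
  assumes "x \<in> p_power scale p \<alpha>" "x \<notin> p_power scale p (ord_suc \<alpha>)"
  shows "p_height scale p x = Fin \<alpha>"
proof -
  have "\<beta> = \<alpha>" if "x \<in> p_power scale p \<beta> - p_power scale p (ord_suc \<beta>)" for \<beta>
  proof (rule linorder_cases[of \<alpha> \<beta>])
    assume "\<alpha> < \<beta>"
    then show ?thesis
      using that assms p_power_antimono[of "ord_suc \<alpha>" \<beta> scale p] by (auto simp: ord_suc_le_iff)
  next
    assume "\<beta> < \<alpha>"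
    then show ?thesis
      using that assms p_power_antimono[of "ord_suc \<beta>" \<alpha> scale p] by (auto simp: ord_suc_le_iff)
  qed simp
  then have "(THE \<alpha>. x \<in> p_power scale p \<alpha> - p_power scale p (ord_suc \<alpha>)) = \<alpha>"
    using assms by (intro the_equality) blast+
  moreover have "\<exists>\<alpha>. x \<in> p_power scale p \<alpha> - p_power scale p (ord_suc \<alpha>)"
    using assms by blast
  ultimately show ?thesis
    unfolding p_height_def by (simp only: if_True)
qed

lemma p_height_eq_Pinf:
  assumes "\<nexists>\<alpha>. x \<in> p_power scale p \<alpha> - p_power scale p (ord_suc \<alpha>)"
  shows "p_height scale p x = Pinf"
  unfolding p_height_def using assms by (rule if_not_P)

lemma Fin_le_p_height_iff: "Fin \<alpha> \<le> p_height scale p x \<longleftrightarrow> x \<in> p_power scale p \<alpha>"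
proof (cases "\<exists>\<beta>. x \<in> p_power scale p \<beta> - p_power scale p (ord_suc \<beta>)")
  case True
  then obtain \<beta> where \<beta>: "x \<in> p_power scale p \<beta>" "x \<notin> p_power scale p (ord_suc \<beta>)"
    by blast
  have "\<alpha> \<le> \<beta> \<longleftrightarrow> x \<in> p_power scale p \<alpha>"
    using \<beta> p_power_antimono[of \<alpha> \<beta> scale p] p_power_antimono[of "ord_suc \<beta>" \<alpha> scale p]
    unfolding ord_suc_le_iff by (meson not_le subsetD)
  then show ?thesis
    by (simp add: p_height_eq_Fin[OF \<beta>])
next
  case False
  \<comment> \<open>The first power to miss \<open>x\<close> could be neither the zeroth nor at a
    limit, and at a successor it would give \<open>x\<close> an ordinal height.\<close>
  have "x \<in> p_power scale p \<alpha>"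
  proof (induction \<alpha> rule: less_induct)
    case (less \<alpha>)
    show ?case
    proof (cases \<alpha> rule: ordinal_cases)
      case zero
      then show ?thesis by (simp add: p_power_zero)
    next
      case (suc \<beta>)
      then show ?thesis
        using less[of \<beta>] False by auto
    next
      case limit
      then show ?thesis
        using less by (auto simp: p_power_limit)
    qed
  qed
  then show ?thesis
    by (simp add: p_height_eq_Pinf[OF False])
qed

text \<open>In this form an inequality of heights can be carried from one module to the other, since
  it speaks only of membership.\<close>

lemma p_height_le_iff:
  "p_height scale p x \<le> p_height scale p y \<longleftrightarrow>
    (\<forall>\<alpha>. x \<in> p_power scale p \<alpha> \<longrightarrow> y \<in> p_power scale p \<alpha>)"
proof
  assume "p_height scale p x \<le> p_height scale p y"
  then show "\<forall>\<alpha>. x \<in> p_power scale p \<alpha> \<longrightarrow> y \<in> p_power scale p \<alpha>"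
    unfolding Fin_le_p_height_iff[symmetric] by (meson order_trans)
next
  assume le: "\<forall>\<alpha>. x \<in> p_power scale p \<alpha> \<longrightarrow> y \<in> p_power scale p \<alpha>"
  show "p_height scale p x \<le> p_height scale p y"
  proof (cases "\<exists>\<alpha>. x \<in> p_power scale p \<alpha> - p_power scale p (ord_suc \<alpha>)")
    case True
    then obtain \<alpha> where "x \<in> p_power scale p \<alpha>" "x \<notin> p_power scale p (ord_suc \<alpha>)"
      by blast
    with le show ?thesis
      by (simp add: p_height_eq_Fin Fin_le_p_height_iff)
  next
    case False
    have "x \<in> p_power scale p \<alpha>" for \<alpha>
      using Fin_le_p_height_iff[of \<alpha> scale p x] unfolding p_height_eq_Pinf[OF False] by simp
    with le have "\<nexists>\<alpha>. y \<in> p_power scale p \<alpha> - p_power scale p (ord_suc \<alpha>)"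
      by blast
    then have "p_height scale p y = Pinf"
      by (rule p_height_eq_Pinf)
    then show ?thesis by simp
  qed
qed

section \<open>Transport along a single isomorphism of submodules\<close>

locale submodule_isomorphism =
  G: module scaleG + H: module scaleH
  for scaleG :: "'r::comm_ring_1 \<Rightarrow> 'g::ab_group_add \<Rightarrow> 'g"
    and scaleH :: "'r \<Rightarrow> 'h::ab_group_add \<Rightarrow> 'h" +
  fixes f :: "'g \<rightharpoonup> 'h"
  assumes iso: "submodule_iso scaleG scaleH f"
begin

abbreviation F :: "'g \<Rightarrow> 'h"
  where "F x \<equiv> the (f x)"

lemma subspace_dom: "G.subspace (dom f)"
  and map_add: "\<And>x y. x \<in> dom f \<Longrightarrow> y \<in> dom f \<Longrightarrow> F (x + y) = F x + F y"
  and map_scale: "\<And>r x. x \<in> dom f \<Longrightarrow> F (scaleG r x) = scaleH r (F x)"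
  using iso unfolding submodule_iso_def by blast+

text \<open>The given injectivity concerns option values; on \<open>dom f\<close> none of them is
  \<open>None\<close>, so stripping \<open>Some\<close> preserves it.\<close>

lemma inj_on_map: "inj_on F (dom f)"
proof (rule inj_onI)
  fix x y assume xy: "x \<in> dom f" "y \<in> dom f" "F x = F y"
  then have "f x = f y"
    by (metis domD option.sel)
  with xy iso show "x = y"
    unfolding submodule_iso_def by (blast dest: inj_onD)
qed

lemma map_zero: "F 0 = 0"
  using map_add[OF G.subspace_0 G.subspace_0, OF subspace_dom subspace_dom] by simp

lemma map_eq_zero_iff: "x \<in> dom f \<Longrightarrow> F x = 0 \<longleftrightarrow> x = 0"
  using inj_on_map map_zero G.subspace_0[OF subspace_dom] by (metis inj_on_eq_iff)

lemma map_lincomb: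
  assumes "S \<subseteq> dom f"
  shows "F (\<Sum>x\<in>S. scaleG (a x) x) = (\<Sum>x\<in>S. scaleH (a x) (F x))"
  using assms
proof (induction S rule: infinite_finite_induct)
  case (insert x S)
  have "(\<Sum>x\<in>S. scaleG (a x) x) \<in> dom f"
    using insert.prems by (intro G.subspace_sum subspace_dom G.subspace_scale) auto
  then show ?case
    using insert by (simp add: map_add map_scale G.subspace_scale[OF subspace_dom])
\<comment> \<open>For infinite \<open>S\<close> both sums are 0 by convention, so that case also
  reduces to \<open>map_zero\<close>.\<close>
qed (simp_all add: map_zero)

lemma map_span:
  assumes "Y \<subseteq> dom f" "x \<in> G.span Y"
  shows "F x \<in> H.span (F ` Y)"
proof -
  \<comment> \<open>Membership in \<open>dom f\<close> is carried through the induction because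
    \<open>F\<close> is known to be linear only there.\<close>
  have "x \<in> dom f \<and> F x \<in> H.span (F ` Y)"
    using assms(2)
  proof (rule G.span_induct)
    show "G.subspace {x. x \<in> dom f \<and> F x \<in> H.span (F ` Y)}"
      using subspace_dom
      by (auto simp: G.subspace_def map_zero map_add map_scale H.span_zero
          intro: H.span_add H.span_scale)
  next
    fix y assume "y \<in> Y"
    then show "y \<in> dom f \<and> F y \<in> H.span (F ` Y)"
      using assms(1) H.span_base[of "F y" "F ` Y"] by blast
  qed
  then show ?thesis ..
qed

lemma map_torsion_closure:
  assumes "Y \<subseteq> dom f" "x \<in> dom f" "x \<in> torsion_closure scaleG (G.span Y)"
  shows "F x \<in> torsion_closure scaleH (H.span (F ` Y))"
  using assms map_span[OF assms(1)] by (auto simp: torsion_closure_def map_scale[symmetric])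

text \<open>A linear relation among images is the image of a combination with the same coefficients,
  and only 0 is mapped to 0.\<close>

lemma map_independent:
  assumes "X \<subseteq> dom f" "\<not> G.dependent X"
  shows "\<not> H.dependent (F ` X)"
proof
  assume "H.dependent (F ` X)"
  then obtain T u where T: "finite T" "T \<subseteq> F ` X" "(\<Sum>v\<in>T. scaleH (u v) v) = 0"
    and ex: "\<exists>v\<in>T. u v \<noteq> 0"
    unfolding H.dependent_explicit by blast
  obtain S where S: "S \<subseteq> X" "finite S" "T = F ` S"
    using T(1,2) by (meson finite_subset_image)
  have inj: "inj_on F S"
    using inj_on_map S(1) assms(1) by (meson inj_on_subset)
  have dom: "S \<subseteq> dom f"
    using S(1) assms(1) by blast
  have "F (\<Sum>x\<in>S. scaleG (u (F x)) x) = 0"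
    using T(3) inj by (simp add: map_lincomb[OF dom] S(3) sum.reindex)
  moreover have "(\<Sum>x\<in>S. scaleG (u (F x)) x) \<in> dom f"
    using dom by (intro G.subspace_sum subspace_dom G.subspace_scale) auto
  ultimately have "(\<Sum>x\<in>S. scaleG (u (F x)) x) = 0"
    by (simp add: map_eq_zero_iff)
  moreover have "\<exists>x\<in>S. u (F x) \<noteq> 0"
    using ex S(3) by blast
  ultimately have "G.dependent X"
    unfolding G.dependent_explicit
    using S(1,2) by (intro exI[of _ S] exI[of _ "\<lambda>x. u (F x)"]) simp
  with assms(2) show False ..
qed

end

section \<open>Back-and-forth within a partial isomorphism\<close>

lemma map_le_the_eq: "f \<subseteq>\<^sub>m g \<Longrightarrow> x \<in> dom f \<Longrightarrow> the (g x) = the (f x)"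
  by (metis map_le_def)

locale partial_isomorphism_between =
  G: module scaleG + H: module scaleH
  for scaleG :: "'r::comm_ring_1 \<Rightarrow> 'g::ab_group_add \<Rightarrow> 'g"
    and scaleH :: "'r \<Rightarrow> 'h::ab_group_add \<Rightarrow> 'h" +
  fixes I :: "('g \<rightharpoonup> 'h) set"
  assumes partial_iso: "partial_isomorphism scaleG scaleH I"
begin

lemma member_iso: "f \<in> I \<Longrightarrow> submodule_isomorphism scaleG scaleH f"
  using partial_iso unfolding partial_isomorphism_def
  by unfold_locales blast

lemma extend_ran:
  assumes "f \<in> I"
  obtains g x where "g \<in> I" "f \<subseteq>\<^sub>m g" "x \<in> dom g" "the (g x) = y"
proof -
  obtain g where "g \<in> I" "f \<subseteq>\<^sub>m g" "y \<in> ran g"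
    using assms partial_iso unfolding partial_isomorphism_def by blast
  moreover from \<open>y \<in> ran g\<close> obtain x where "g x = Some y"
    by (auto simp: ran_def)
  ultimately show thesis
    by (intro that[of g x]) auto
qed

text \<open>The forth property adds one element at a time; this is how finiteness of the members of
  a partial decomposition basis enters.\<close>

lemma extend_dom_finite:
  assumes "f \<in> I" "finite X"
  obtains g where "g \<in> I" "f \<subseteq>\<^sub>m g" "X \<subseteq> dom g"
proof -
  have "\<exists>g\<in>I. f \<subseteq>\<^sub>m g \<and> X \<subseteq> dom g"
    using assms(2)
  proof induction
    case empty
    then show ?case using assms(1) map_le_refl by blast
  next
    case (insert x X)
    then obtain g where g: "g \<in> I" "f \<subseteq>\<^sub>m g" "X \<subseteq> dom g"
      by blast
    obtain h where "h \<in> I" "g \<subseteq>\<^sub>m h" "x \<in> dom h"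
      using g(1) partial_iso unfolding partial_isomorphism_def by blast
    with g show ?case
      by (meson insert_subset map_le_implies_dom_le map_le_trans order_trans)
  qed
  with that show thesis by blast
qed

text \<open>A substitute for saying that \<open>B\<close> is the image of \<open>A\<close>, which
  makes no direct sense when no member of \<open>I\<close> is defined on all of
  \<open>A\<close>.\<close>

definition corresponding :: "'g set \<Rightarrow> 'h set \<Rightarrow> bool"
  where "corresponding A B \<longleftrightarrow> (\<forall>f\<in>I. \<forall>x\<in>dom f. x \<in> A \<longleftrightarrow> the (f x) \<in> B)"

text \<open>The element that \<open>p\<close> multiplies may lie outside the domain or range of
  \<open>f\<close>. Extending \<open>f\<close> reaches it: the forth property gives one direction,
  the back property the other.\<close>

lemma corresponding_scale:
  assumes "corresponding A B"
  shows "corresponding (scaleG p ` A) (scaleH p ` B)"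
  unfolding corresponding_def
proof (intro ballI iffI)
  fix f x
  assume f: "f \<in> I" "x \<in> dom f"
  {
    assume "x \<in> scaleG p ` A"
    then obtain z where z: "z \<in> A" "x = scaleG p z"
      by blast
    obtain g where g: "g \<in> I" "f \<subseteq>\<^sub>m g" "{z} \<subseteq> dom g"
      using extend_dom_finite[OF f(1), of "{z}"] by blast
    interpret g: submodule_isomorphism scaleG scaleH g
      using g(1) by (rule member_iso)
    have "the (f x) = scaleH p (the (g z))"
      using g z f(2) by (simp add: g.map_scale flip: map_le_the_eq)
    moreover have "the (g z) \<in> B"
      using assms g(1,3) z(1) by (auto simp: corresponding_def)
    ultimately show "the (f x) \<in> scaleH p ` B"
      by blast
  next
    assume "the (f x) \<in> scaleH p ` B"
    then obtain w where w: "w \<in> B" "the (f x) = scaleH p w"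
      by blast
    obtain g z where g: "g \<in> I" "f \<subseteq>\<^sub>m g" "z \<in> dom g" "the (g z) = w"
      using extend_ran[OF f(1)] by blast
    interpret g: submodule_isomorphism scaleG scaleH g
      using g(1) by (rule member_iso)
    \<comment> \<open>The factorization found in \<open>H\<close> is pulled back to \<open>G\<close>
      by injectivity of \<open>g\<close>.\<close>
    have "the (g x) = the (g (scaleG p z))"
      using g w f(2) by (simp add: g.map_scale map_le_the_eq)
    moreover have "x \<in> dom g" "scaleG p z \<in> dom g"
      using f(2) g(2,3) map_le_implies_dom_le G.subspace_scale[OF g.subspace_dom] by blast+
    ultimately have "x = scaleG p z"
      using g.inj_on_map by (meson inj_onD)
    moreover have "z \<in> A"
      using assms g w(1) unfolding corresponding_def by blast
    ultimately show "x \<in> scaleG p ` A"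
      by blast
  }
qed

text \<open>The ordinals \<open>\<alpha>\<close> and \<open>\<beta>\<close> live in different types, and \<open>'h ordinal\<close> may be the longer one;
  past the point where the chain of \<open>G\<close> becomes stationary they are no longer equal.\<close>

lemma p_power_corresponding:
  "\<exists>\<alpha>. corresponding (p_power scaleG p \<alpha>) (p_power scaleH p \<beta>)"
proof (induction \<beta> rule: less_induct)
  case (less \<beta>)
  show ?case
  proof (cases \<beta> rule: ordinal_cases)
    case zero
    then show ?thesis
      by (intro exI[of _ ord_zero]) (simp add: p_power_zero corresponding_def)
  next
    case (suc \<gamma>)
    then obtain \<alpha> where "corresponding (p_power scaleG p \<alpha>) (p_power scaleH p \<gamma>)"
      using less[of \<gamma>] by auto
    then have "corresponding (p_power scaleG p (ord_suc \<alpha>)) (p_power scaleH p \<beta>)"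
      unfolding suc p_power_suc by (rule corresponding_scale)
    then show ?thesis ..
  next
    case limit
    obtain A where A: "\<And>\<gamma>. \<gamma> < \<beta> \<Longrightarrow> corresponding (p_power scaleG p (A \<gamma>)) (p_power scaleH p \<gamma>)"
      using less by metis
    \<comment> \<open>Nothing is known about how the chosen \<open>A \<gamma>\<close> varies with
      \<gamma>, so the intersection of these powers is identified by
      \<open>INT_p_power\<close>.\<close>
    obtain \<alpha> where \<alpha>: "(\<Inter>\<sigma>\<in>A ` {..<\<beta>}. p_power scaleG p \<sigma>) = p_power scaleG p \<alpha>"
      using INT_p_power[of scaleG p "A ` {..<\<beta>}"] by (elim exE)
    have "corresponding (p_power scaleG p \<alpha>) (p_power scaleH p \<beta>)"
      using A unfolding p_power_limit[OF limit] \<alpha>[symmetric] corresponding_def by blast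
    then show ?thesis ..
  qed
qed

text \<open>Membership of \<open>the (f x)\<close> in a power of \<open>H\<close> is pulled back to
  the matching power of \<open>G\<close>, passed from \<open>x\<close> to \<open>y\<close> there,
  and pushed forward again.\<close>

lemma p_height_mono:
  assumes "f \<in> I" "x \<in> dom f" "y \<in> dom f" "p_height scaleG p x \<le> p_height scaleG p y"
  shows "p_height scaleH p (the (f x)) \<le> p_height scaleH p (the (f y))"
  unfolding p_height_le_iff
proof (intro allI impI)
  fix \<beta>
  assume "the (f x) \<in> p_power scaleH p \<beta>"
  moreover obtain \<alpha> where "corresponding (p_power scaleG p \<alpha>) (p_power scaleH p \<beta>)"
    using p_power_corresponding by blast
  ultimately show "the (f y) \<in> p_power scaleH p \<beta>"
    using assms unfolding corresponding_def p_height_le_iff by blast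
qed

end

section \<open>Transport of decomposition sets and bases\<close>

text \<open>In \<open>G\<close> the minimum is attained by some term, which has the same height as
  the sum. Monotonicity in both directions makes their images equal in height, and the images of the
  other terms are at least as high.\<close>

lemma decomposition_set_image:
  fixes scaleG :: "'r::idom \<Rightarrow> 'g::ab_group_add \<Rightarrow> 'g"
    and scaleH :: "'r \<Rightarrow> 'h::ab_group_add \<Rightarrow> 'h"
  assumes "partial_isomorphism_between scaleG scaleH I"
    and "f \<in> I" "X \<subseteq> dom f" and X: "decomposition_set scaleG X"
  shows "decomposition_set scaleH ((\<lambda>x. the (f x)) ` X)"
proof -
  interpret I: partial_isomorphism_between scaleG scaleH I
    by fact
  interpret f: submodule_isomorphism scaleG scaleH f
    using assms(2) by (rule I.member_iso)
  have scale_dom: "scaleG a x \<in> dom f" if "x \<in> X" for a x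
    using that assms(3) I.G.subspace_scale[OF f.subspace_dom] by blast
  show ?thesis
    unfolding decomposition_set_def
  proof (intro conjI ballI allI impI)
    show "\<not> I.H.dependent (f.F ` X)"
      using X assms(3) unfolding decomposition_set_def by (intro f.map_independent) auto
  next
    fix y a
    assume "y \<in> f.F ` X" "scaleH a y = 0"
    then obtain x where x: "x \<in> X" "f.F (scaleG a x) = 0"
      using assms(3) by (auto simp: f.map_scale subset_iff)
    then have "scaleG a x = 0"
      using scale_dom f.map_eq_zero_iff by blast
    with x(1) X show "a = 0"
      unfolding decomposition_set_def by blast
  next
    fix T and a :: "'h \<Rightarrow> 'r" and p :: 'r
    assume T: "finite T" "T \<noteq> {}" "T \<subseteq> f.F ` X" and p: "prime_elem p"
    obtain S where S: "S \<subseteq> X" "finite S" "T = f.F ` S"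
      using T(1,3) by (meson finite_subset_image)
    \<comment> \<open>The coefficients are indexed by elements of \<open>H\<close>; \<open>b\<close>
      reindexes them by preimages in \<open>G\<close>.\<close>
    define b where "b = (\<lambda>x. a (f.F x))"
    let ?hG = "p_height scaleG p" and ?hH = "p_height scaleH p"
    let ?s = "\<Sum>x\<in>S. scaleG (b x) x"
    have dom: "S \<subseteq> dom f"
      using S(1) assms(3) by blast
    have s_dom: "?s \<in> dom f"
      using S(1) scale_dom by (intro I.G.subspace_sum f.subspace_dom) blast
    have "inj_on f.F S"
      using f.inj_on_map dom by (meson inj_on_subset)
    then have s: "(\<Sum>y\<in>T. scaleH (a y) y) = f.F ?s"
      by (simp add: f.map_lincomb[OF dom] S(3) sum.reindex b_def)
    have terms: "(\<lambda>y. ?hH (scaleH (a y) y)) ` T = (\<lambda>x. ?hH (f.F (scaleG (b x) x))) ` S"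
      using dom by (auto simp: S(3) image_image b_def f.map_scale subset_iff)
    have "S \<noteq> {}"
      using S(3) T(2) by blast
    with S p X have hs: "?hG ?s = Min ((\<lambda>x. ?hG (scaleG (b x) x)) ` S)"
      unfolding decomposition_set_def by blast
    have "Min ((\<lambda>x. ?hG (scaleG (b x) x)) ` S) \<in> (\<lambda>x. ?hG (scaleG (b x) x)) ` S"
      using S(2) \<open>S \<noteq> {}\<close> by (intro Min_in) auto
    then obtain z where z: "z \<in> S" "?hG (scaleG (b z) z) = ?hG ?s"
      using hs by auto
    have lower: "?hH (f.F ?s) \<le> ?hH (f.F (scaleG (b x) x))" if "x \<in> S" for x
    proof (rule I.p_height_mono[OF assms(2) s_dom])
      show "scaleG (b x) x \<in> dom f"
        using that S(1) scale_dom by blast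
      show "?hG ?s \<le> ?hG (scaleG (b x) x)"
        using that S(2) by (simp add: hs)
    qed
    have "?hH (f.F (scaleG (b z) z)) \<le> ?hH (f.F ?s)"
      using z S(1) scale_dom by (intro I.p_height_mono[OF assms(2) _ s_dom]) auto
    with lower[OF z(1)] have "?hH (f.F ?s) = ?hH (f.F (scaleG (b z) z))"
      by (rule antisym)
    with z(1) S(2) lower show "?hH (\<Sum>y\<in>T. scaleH (a y) y) = Min ((\<lambda>y. ?hH (scaleH (a y) y)) ` T)"
      unfolding s terms by (intro Min_eqI[symmetric]) auto
  qed
qed

text \<open>For the extension condition, \<open>f\<close> is extended to some \<open>g\<close> that
  takes a value \<open>x\<close> to \<open>y\<close>, \<open>X\<close> is enlarged to
  \<open>Y\<close> to capture \<open>x\<close>, and \<open>g\<close> is extended to \<open>h\<close>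
  on all of \<open>Y\<close>. The image of \<open>Y\<close> under \<open>h\<close> is the required
  set.\<close>

lemma partial_decomposition_basis_image:
  fixes scaleG :: "'r::idom \<Rightarrow> 'g::ab_group_add \<Rightarrow> 'g"
    and scaleH :: "'r \<Rightarrow> 'h::ab_group_add \<Rightarrow> 'h"
  assumes "partial_isomorphism_between scaleG scaleH I"
    and C: "partial_decomposition_basis scaleG C"
  shows "partial_decomposition_basis scaleH
    {(\<lambda>x. the (f x)) ` X | X f. X \<in> C \<and> f \<in> I \<and> X \<subseteq> dom f}"
    (is "partial_decomposition_basis scaleH ?D")
proof -
  interpret I: partial_isomorphism_between scaleG scaleH I
    by fact
  have fin: "finite X" if "X \<in> C" for X
    using that C by (simp add: partial_decomposition_basis_def)
  show ?thesis
    unfolding partial_decomposition_basis_def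
  proof (intro conjI ballI allI)
    \<comment> \<open>An arbitrary \<open>f\<close> need not be defined on \<open>X\<close>, so it
      is first extended to a member of \<open>I\<close> that is.\<close>
    obtain X f where "X \<in> C" "f \<in> I"
      using C I.partial_iso unfolding partial_decomposition_basis_def partial_isomorphism_def
      by blast
    moreover obtain g where "g \<in> I" "X \<subseteq> dom g"
      using I.extend_dom_finite[OF \<open>f \<in> I\<close> fin[OF \<open>X \<in> C\<close>]] by blast
    ultimately show "?D \<noteq> {}"
      by blast
  next
    fix Z assume "Z \<in> ?D"
    then show "finite Z"
      using fin by auto
  next
    fix Z assume "Z \<in> ?D"
    then show "decomposition_set scaleH Z"
      using decomposition_set_image[OF assms(1)] C
      unfolding partial_decomposition_basis_def by blast
  next
    fix Z y
    assume "Z \<in> ?D"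
    then obtain X f where X: "X \<in> C" "f \<in> I" "X \<subseteq> dom f" "Z = (\<lambda>x. the (f x)) ` X"
      by blast
    obtain g x where g: "g \<in> I" "f \<subseteq>\<^sub>m g" "x \<in> dom g" "the (g x) = y"
      using I.extend_ran[OF X(2)] by blast
    obtain Y where Y: "Y \<in> C" "X \<subseteq> Y" "x \<in> torsion_closure scaleG (I.G.span Y)"
      using C X(1) unfolding partial_decomposition_basis_def by blast
    obtain h where h: "h \<in> I" "g \<subseteq>\<^sub>m h" "Y \<subseteq> dom h"
      using I.extend_dom_finite[OF g(1) fin[OF Y(1)]] by blast
    interpret h: submodule_isomorphism scaleG scaleH h
      using h(1) by (rule I.member_iso)
    \<comment> \<open>Replacing \<open>f\<close> by its extension \<open>h\<close> leaves the image
      of \<open>X\<close> unchanged, so \<open>Z\<close> lies in the image of \<open>Y\<close> under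
      \<open>h\<close>.\<close>
    have "f \<subseteq>\<^sub>m h"
      using g(2) h(2) by (rule map_le_trans)
    then have "Z = h.F ` X"
      unfolding X(4) using X(3) by (intro image_cong) (auto simp: map_le_the_eq subset_iff)
    then have "Z \<subseteq> h.F ` Y"
      using Y(2) by blast
    have "h.F x = y"
      using map_le_the_eq[OF h(2) g(3)] g(4) by simp
    moreover have "x \<in> dom h"
      using g(3) map_le_implies_dom_le[OF h(2)] by blast
    ultimately have "y \<in> torsion_closure scaleH (I.H.span (h.F ` Y))"
      using h.map_torsion_closure[OF h(3) _ Y(3)] by simp
    with \<open>Z \<subseteq> h.F ` Y\<close> show "\<exists>W\<in>?D. Z \<subseteq> W \<and> y \<in> torsion_closure scaleH (I.H.span W)"
      using Y(1) h(1,3) by blast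
  qed
qed

theorem theorem5:
  fixes scaleG :: "'r::principal_ideal_domain \<Rightarrow> 'g::ab_group_add \<Rightarrow> 'g"
    and scaleH :: "'r \<Rightarrow> 'h::ab_group_add \<Rightarrow> 'h"
  assumes "module scaleG" and "module scaleH"
  shows
    "(\<forall>C I. partial_decomposition_basis scaleG C \<longrightarrow>
        partial_isomorphism scaleG scaleH I \<longrightarrow>
        partial_decomposition_basis scaleH
          {(\<lambda>x. the (f x)) ` X | X f. X \<in> C \<and> f \<in> I \<and> X \<subseteq> dom f}) \<and>
     (partially_isomorphic scaleG scaleH \<longrightarrow>
        (\<exists>C. partial_decomposition_basis scaleG C) \<longrightarrow>
        (\<exists>D. partial_decomposition_basis scaleH D))"
proof -
  have "partial_isomorphism_between scaleG scaleH I" if "partial_isomorphism scaleG scaleH I" for I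
    using assms that
    by (simp add: partial_isomorphism_between_def partial_isomorphism_between_axioms_def)
  then show ?thesis
    unfolding partially_isomorphic_def by (blast intro: partial_decomposition_basis_image)
qed

end
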